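(* Let $\sigma_1,\dots,\sigma_d$ be permutation patterns (not necessarily distinct, not necessarily of the same size) with $\sigma_i\in S_{k_i}$, and let $K=k_1+\dots+k_d$. Then there is a polynomial $Q$ in variables $n,m_1,\dots,m_K$, of degree at most $K$ when $n$ is given degree $1$ and $m_i$ degree $i$, such that for all $n\ge 1$ and all $\pi\in S_n$, $M_{\sigma_1,\dots,\sigma_d,n}(\pi)=Q(n,m_1(\pi),\dots,m_K(\pi))$.
   Context: For $\pi\in S_n$ and $\sigma\in S_k$, an occurrence of $\sigma$ in $\pi$ is a sequence $i_1<\dots<i_k$ in $[n]$ such that $\pi(i_a)>\pi(i_b)$ iff $\sigma(a)>\sigma(b)$; $N_\sigma(\pi)$ is the number of occurrences. $m_i(\pi)$ is the number of $i$-cycles of $\pi$. $M_{\sigma_1,\dots,\sigma_d,n}(\pi)=\frac1{|C_\pi|}\sum_{\pi'\in C_\pi}N_{\sigma_1}(\pi')\cdots N_{\sigma_d}(\pi')$, where $C_\pi$ is the conjugacy class of $\pi$ in $S_n$. *)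

theory Defs
  imports Complex_Main "HOL-Library.FuncSet" "HOL-Library.Poly_Mapping"
    "HOL-Combinatorics.Combinatorics"
begin

text \<open>
  The symmetric group $S_n$ consists of the functions \<open>p :: nat \<Rightarrow> nat\<close> with
  \<open>p permutes {1..n}\<close>; such a function is the identity outside \<open>{1..n}\<close>.
\<close>

text \<open>
  A sequence $i_1 < \dots < i_k$ in $[n]$ is an extensional function on \<open>{1..k}\<close>, so that
  distinct functions are distinct sequences.
\<close>

definition occurrences ::
    "nat \<Rightarrow> (nat \<Rightarrow> nat) \<Rightarrow> nat \<Rightarrow> (nat \<Rightarrow> nat) \<Rightarrow> (nat \<Rightarrow> nat) set" where
  "occurrences k \<sigma> n \<pi> =
     {i \<in> {1..k} \<rightarrow>\<^sub>E {1..n}. strict_mono_on {1..k} i \<and>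
        (\<forall>a\<in>{1..k}. \<forall>b\<in>{1..k}. \<pi> (i a) > \<pi> (i b) \<longleftrightarrow> \<sigma> a > \<sigma> b)}"

definition num_occurrences ::
    "nat \<Rightarrow> (nat \<Rightarrow> nat) \<Rightarrow> nat \<Rightarrow> (nat \<Rightarrow> nat) \<Rightarrow> nat" where
  "num_occurrences k \<sigma> n \<pi> = card (occurrences k \<sigma> n \<pi>)"

text \<open>Cycles are identified with their supports, so fixed points are the 1-cycles.\<close>

definition num_cycles :: "nat \<Rightarrow> (nat \<Rightarrow> nat) \<Rightarrow> nat \<Rightarrow> nat" where
  "num_cycles n \<pi> i = card {C \<in> orbit \<pi> ` {1..n}. card C = i}"

definition conj_class :: "nat \<Rightarrow> (nat \<Rightarrow> nat) \<Rightarrow> (nat \<Rightarrow> nat) set" where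
  "conj_class n \<pi> = {\<tau> \<circ> \<pi> \<circ> inv \<tau> | \<tau>. \<tau> permutes {1..n}}"

definition pattern_moment ::
    "nat \<Rightarrow> (nat \<Rightarrow> nat) \<Rightarrow> (nat \<Rightarrow> nat \<Rightarrow> nat) \<Rightarrow> nat \<Rightarrow> (nat \<Rightarrow> nat) \<Rightarrow> rat" where
  "pattern_moment d k \<sigma> n \<pi> =
     1 / of_nat (card (conj_class n \<pi>)) *
       (\<Sum>\<pi>'\<in>conj_class n \<pi>. \<Prod>j\<in>{1..d}. of_nat (num_occurrences (k j) (\<sigma> j) n \<pi>'))"

text \<open>
  Multivariate polynomials as finitely supported maps from monomials to coefficients, a monomial
  being a finitely supported map from variables to exponents.
\<close>

type_synonym ('v, 'a) mvpoly = "('v \<Rightarrow>\<^sub>0 nat) \<Rightarrow>\<^sub>0 'a"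

definition mvpoly_vars :: "('v, 'a::zero) mvpoly \<Rightarrow> 'v set" where
  "mvpoly_vars p = (\<Union>m\<in>Poly_Mapping.keys p. Poly_Mapping.keys m)"

definition mvpoly_eval :: "('v \<Rightarrow> 'a) \<Rightarrow> ('v, 'a::comm_semiring_1) mvpoly \<Rightarrow> 'a" where
  "mvpoly_eval \<alpha> p =
     (\<Sum>m\<in>Poly_Mapping.keys p. Poly_Mapping.lookup p m *
        (\<Prod>v\<in>Poly_Mapping.keys m. \<alpha> v ^ Poly_Mapping.lookup m v))"

text \<open>Degree with respect to a weight on the variables; the zero polynomial gets degree 0.\<close>

definition mvpoly_wdegree :: "('v \<Rightarrow> nat) \<Rightarrow> ('v, 'a::zero) mvpoly \<Rightarrow> nat" where
  "mvpoly_wdegree w p =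
     Max (insert 0 ((\<lambda>m. \<Sum>v\<in>Poly_Mapping.keys m. Poly_Mapping.lookup m v * w v) `
       Poly_Mapping.keys p))"

text \<open>The indeterminates $n, m_1, m_2, \dots$\<close>

datatype var = VarN | VarM nat

fun var_weight :: "var \<Rightarrow> nat" where
  "var_weight VarN = 1"
| "var_weight (VarM i) = i"

fun var_value :: "nat \<Rightarrow> (nat \<Rightarrow> nat) \<Rightarrow> var \<Rightarrow> rat" where
  "var_value n \<pi> VarN = of_nat n"
| "var_value n \<pi> (VarM i) = of_nat (num_cycles n \<pi> i)"

end

theory Submission
  imports Defs "HOL-Library.Infinite_Set"
begin

text \<open>
  The moment is the average over $\tau \in S_n$ of the product of occurrence numbers of
  $\tau\pi\tau^{-1}$. That product counts the vectors $x \in [n]^K$ such that the $2K$ numbers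
  $x_v, \tau\pi\tau^{-1}(x_v)$ satisfy a condition on their relative order. After substituting
  $\tau y$ for $x$ these numbers are the images under $\tau$ of the $2K$ numbers $y_v, \pi(y_v)$.
  A random $\tau$ puts the distinct ones among them in a uniformly random order, so the probability
  of the condition depends only on which of them coincide. It remains to see that the number of
  $y \in [n]^K$ with prescribed coincidences is a polynomial of degree at most $K$. By
  inclusion-exclusion this reduces to systems of equations $\pi^p(y_a) = \pi^q(y_b)$, in which
  variables can be eliminated until each equation involves a single variable. The equation
  $\pi^p(y) = \pi^q(y)$ with $p \neq q$ says that the length $i$ of the cycle of $y$ divides $p - q$,
  and has $\sum i\, m_i$ solutions, the sum being over such $i$.
\<close>

section \<open>Evaluation and weighted degree of multivariate polynomials\<close>

definition mono_eval :: "('v \<Rightarrow> 'a) \<Rightarrow> ('v \<Rightarrow>\<^sub>0 nat) \<Rightarrow> 'a::comm_semiring_1" where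
  "mono_eval \<alpha> m = (\<Prod>v\<in>Poly_Mapping.keys m. \<alpha> v ^ Poly_Mapping.lookup m v)"

definition mono_wdegree :: "('v \<Rightarrow> nat) \<Rightarrow> ('v \<Rightarrow>\<^sub>0 nat) \<Rightarrow> nat" where
  "mono_wdegree w m = (\<Sum>v\<in>Poly_Mapping.keys m. Poly_Mapping.lookup m v * w v)"

text \<open>Extra variables have exponent 0 and contribute a factor 1. Two monomials can therefore
  be treated over a common index set, as the addition laws require.\<close>

lemma mono_eval_superset:
  assumes "finite A" "Poly_Mapping.keys m \<subseteq> A"
  shows "mono_eval \<alpha> m = (\<Prod>v\<in>A. \<alpha> v ^ Poly_Mapping.lookup m v)"
  unfolding mono_eval_def using assms
  by (intro prod.mono_neutral_left) (auto simp: in_keys_iff)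

lemma mono_wdegree_superset:
  assumes "finite A" "Poly_Mapping.keys m \<subseteq> A"
  shows "mono_wdegree w m = (\<Sum>v\<in>A. Poly_Mapping.lookup m v * w v)"
  unfolding mono_wdegree_def using assms
  by (intro sum.mono_neutral_left) (auto simp: in_keys_iff)

lemma mono_eval_add: "mono_eval \<alpha> (m + m') = mono_eval \<alpha> m * mono_eval \<alpha> m'"
proof -
  let ?A = "Poly_Mapping.keys m \<union> Poly_Mapping.keys m'"
  have "mono_eval \<alpha> (m + m') = (\<Prod>v\<in>?A. \<alpha> v ^ Poly_Mapping.lookup (m + m') v)"
    by (rule mono_eval_superset) (use Poly_Mapping.keys_add[of m m'] in auto)
  also have "\<dots> = mono_eval \<alpha> m * mono_eval \<alpha> m'"
    by (simp add: mono_eval_superset[of ?A] lookup_add power_add prod.distrib)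
  finally show ?thesis .
qed

lemma mono_wdegree_add: "mono_wdegree w (m + m') = mono_wdegree w m + mono_wdegree w m'"
proof -
  let ?A = "Poly_Mapping.keys m \<union> Poly_Mapping.keys m'"
  have "mono_wdegree w (m + m') = (\<Sum>v\<in>?A. Poly_Mapping.lookup (m + m') v * w v)"
    by (rule mono_wdegree_superset) (use Poly_Mapping.keys_add[of m m'] in auto)
  also have "\<dots> = mono_wdegree w m + mono_wdegree w m'"
    by (simp add: mono_wdegree_superset[of ?A] lookup_add distrib_right sum.distrib)
  finally show ?thesis .
qed

lemma mvpoly_eval_altdef:
  "mvpoly_eval \<alpha> p = (\<Sum>m\<in>Poly_Mapping.keys p. Poly_Mapping.lookup p m * mono_eval \<alpha> m)"
  by (simp add: mvpoly_eval_def mono_eval_def)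

lemma mvpoly_wdegree_le_iff:
  "mvpoly_wdegree w p \<le> D \<longleftrightarrow> (\<forall>m\<in>Poly_Mapping.keys p. mono_wdegree w m \<le> D)"
  by (auto simp: mvpoly_wdegree_def mono_wdegree_def)

lemma mvpoly_eval_superset:
  assumes "finite A" "Poly_Mapping.keys p \<subseteq> A"
  shows "mvpoly_eval \<alpha> p = (\<Sum>m\<in>A. Poly_Mapping.lookup p m * mono_eval \<alpha> m)"
  unfolding mvpoly_eval_altdef using assms
  by (intro sum.mono_neutral_left) (auto simp: in_keys_iff)

lemma mvpoly_eval_add: "mvpoly_eval \<alpha> (p + q) = mvpoly_eval \<alpha> p + mvpoly_eval \<alpha> q"
proof -
  let ?A = "Poly_Mapping.keys p \<union> Poly_Mapping.keys q"
  have "mvpoly_eval \<alpha> (p + q) = (\<Sum>m\<in>?A. Poly_Mapping.lookup (p + q) m * mono_eval \<alpha> m)"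
    by (rule mvpoly_eval_superset) (use Poly_Mapping.keys_add[of p q] in auto)
  also have "\<dots> = mvpoly_eval \<alpha> p + mvpoly_eval \<alpha> q"
    by (simp add: mvpoly_eval_superset[of ?A] lookup_add distrib_right sum.distrib)
  finally show ?thesis .
qed

lemma mvpoly_eval_single: "mvpoly_eval \<alpha> (Poly_Mapping.single m c) = c * mono_eval \<alpha> m"
  by (simp add: mvpoly_eval_altdef)

section \<open>Functions of n and \<pi> given by polynomials of bounded degree\<close>

text \<open>
  The variable \<open>VarM 0\<close> has weight 0 and must be excluded explicitly; a degree bound \<open>D\<close> then
  excludes every \<open>VarM i\<close> with \<open>i > D\<close>.
\<close>

definition cycle_poly :: "nat \<Rightarrow> (nat \<Rightarrow> (nat \<Rightarrow> nat) \<Rightarrow> rat) \<Rightarrow> bool" where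
  "cycle_poly D f \<longleftrightarrow> (\<exists>Q :: (var, rat) mvpoly.
     VarM 0 \<notin> mvpoly_vars Q \<and> mvpoly_wdegree var_weight Q \<le> D \<and>
     (\<forall>n \<pi>. \<pi> permutes {1..n} \<longrightarrow> f n \<pi> = mvpoly_eval (var_value n \<pi>) Q))"

lemma cycle_poly_cong:
  assumes "cycle_poly D f" "\<And>n \<pi>. \<pi> permutes {1..n} \<Longrightarrow> g n \<pi> = f n \<pi>"
  shows "cycle_poly D g"
  using assms unfolding cycle_poly_def by metis

lemma cycle_poly_monomial:
  assumes "VarM 0 \<notin> Poly_Mapping.keys m" "mono_wdegree var_weight m \<le> D"
  shows "cycle_poly D (\<lambda>n \<pi>. c * mono_eval (var_value n \<pi>) m)"
  unfolding cycle_poly_def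
  by (rule exI[of _ "Poly_Mapping.single m c"])
     (use assms in \<open>auto simp: mvpoly_eval_single mvpoly_vars_def mvpoly_wdegree_le_iff\<close>)

lemma cycle_poly_const: "cycle_poly D (\<lambda>n \<pi>. c)"
  using cycle_poly_monomial[of 0 D c] by (simp add: mono_eval_def mono_wdegree_def)

lemma cycle_poly_var:
  assumes "v \<noteq> VarM 0" "var_weight v \<le> D"
  shows "cycle_poly D (\<lambda>n \<pi>. var_value n \<pi> v)"
  using cycle_poly_monomial[of "Poly_Mapping.single v 1" D 1] assms
  by (simp add: mono_eval_def mono_wdegree_def)

lemma cycle_poly_add:
  assumes "cycle_poly D f" "cycle_poly D g"
  shows "cycle_poly D (\<lambda>n \<pi>. f n \<pi> + g n \<pi>)"
proof -
  from assms(1) obtain P :: "(var, rat) mvpoly" where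
    P: "VarM 0 \<notin> mvpoly_vars P" "mvpoly_wdegree var_weight P \<le> D"
       "\<And>n \<pi>. \<pi> permutes {1..n} \<Longrightarrow> f n \<pi> = mvpoly_eval (var_value n \<pi>) P"
    unfolding cycle_poly_def by blast
  from assms(2) obtain Q :: "(var, rat) mvpoly" where
    Q: "VarM 0 \<notin> mvpoly_vars Q" "mvpoly_wdegree var_weight Q \<le> D"
       "\<And>n \<pi>. \<pi> permutes {1..n} \<Longrightarrow> g n \<pi> = mvpoly_eval (var_value n \<pi>) Q"
    unfolding cycle_poly_def by blast
  have "Poly_Mapping.keys (P + Q) \<subseteq> Poly_Mapping.keys P \<union> Poly_Mapping.keys Q"
    by (rule Poly_Mapping.keys_add)
  then show ?thesis unfolding cycle_poly_def
    by (intro exI[of _ "P + Q"])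
       (use P Q in \<open>auto simp: mvpoly_eval_add mvpoly_vars_def mvpoly_wdegree_le_iff\<close>)
qed

lemma cycle_poly_sum:
  assumes "\<And>i. i \<in> A \<Longrightarrow> cycle_poly D (f i)"
  shows "cycle_poly D (\<lambda>n \<pi>. \<Sum>i\<in>A. f i n \<pi>)"
  using assms
  by (induction A rule: infinite_finite_induct) (simp_all add: cycle_poly_const cycle_poly_add)

lemma cycle_poly_mult:
  assumes "cycle_poly D f" "cycle_poly E g"
  shows "cycle_poly (D + E) (\<lambda>n \<pi>. f n \<pi> * g n \<pi>)"
proof -
  from assms(1) obtain P :: "(var, rat) mvpoly" where
    P: "VarM 0 \<notin> mvpoly_vars P" "mvpoly_wdegree var_weight P \<le> D"
       "\<And>n \<pi>. \<pi> permutes {1..n} \<Longrightarrow> f n \<pi> = mvpoly_eval (var_value n \<pi>) P"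
    unfolding cycle_poly_def by blast
  from assms(2) obtain Q :: "(var, rat) mvpoly" where
    Q: "VarM 0 \<notin> mvpoly_vars Q" "mvpoly_wdegree var_weight Q \<le> E"
       "\<And>n \<pi>. \<pi> permutes {1..n} \<Longrightarrow> g n \<pi> = mvpoly_eval (var_value n \<pi>) Q"
    unfolding cycle_poly_def by blast
  \<comment> \<open>The product is expanded into a double sum of monomials, so that closure under
    sums suffices and no evaluation law for \<open>P * Q\<close> is involved.\<close>
  have "cycle_poly (D + E) (\<lambda>n \<pi>. \<Sum>m\<in>Poly_Mapping.keys P. \<Sum>m'\<in>Poly_Mapping.keys Q.
      (Poly_Mapping.lookup P m * Poly_Mapping.lookup Q m') * mono_eval (var_value n \<pi>) (m + m'))"
  proof (intro cycle_poly_sum cycle_poly_monomial)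
    fix m m' assume m: "m \<in> Poly_Mapping.keys P" "m' \<in> Poly_Mapping.keys Q"
    show "VarM 0 \<notin> Poly_Mapping.keys (m + m')"
      using Poly_Mapping.keys_add[of m m'] P(1) Q(1) m by (auto simp: mvpoly_vars_def)
    show "mono_wdegree var_weight (m + m') \<le> D + E"
      using P(2) Q(2) m by (auto simp: mono_wdegree_add mvpoly_wdegree_le_iff intro: add_mono)
  qed
  then show ?thesis
    by (rule cycle_poly_cong)
       (simp add: P(3) Q(3) mvpoly_eval_altdef sum_product mono_eval_add mult_ac)
qed

lemma cycle_poly_cmult:
  assumes "cycle_poly D f"
  shows "cycle_poly D (\<lambda>n \<pi>. c * f n \<pi>)"
  using cycle_poly_mult[OF cycle_poly_const[of 0] assms] by simp

lemma cycle_poly_diff: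
  assumes "cycle_poly D f" "cycle_poly D g"
  shows "cycle_poly D (\<lambda>n \<pi>. f n \<pi> - g n \<pi>)"
  using cycle_poly_add[OF assms(1) cycle_poly_cmult[OF assms(2), of "-1"]] by simp

lemma cycle_poly_prod:
  assumes "\<And>i. i \<in> A \<Longrightarrow> cycle_poly (D i) (f i)"
  shows "cycle_poly (\<Sum>i\<in>A. D i) (\<lambda>n \<pi>. \<Prod>i\<in>A. f i n \<pi>)"
  using assms
  by (induction A rule: infinite_finite_induct) (simp_all add: cycle_poly_const cycle_poly_mult)

section \<open>Cycle lengths and iterates of a permutation\<close>

text \<open>Every exponent can be reduced modulo the least power, and the iterates with smaller
  exponents are distinct. This connects the orbits in \<open>num_cycles\<close> with the
  divisibility facts about \<open>least_power\<close>.\<close>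

lemma card_orbit_eq_least_power:
  assumes "permutation p"
  shows "card (orbit p x) = least_power p x"
proof -
  let ?l = "least_power p x"
  have l: "(p ^^ ?l) x = x" "?l > 0"
    using least_power_of_permutation[OF assms] by auto
  have "orbit p x = (\<lambda>i. (p ^^ i) x) ` {0..<?l}"
  proof -
    have *: "(p ^^ i) x \<in> (\<lambda>i. (p ^^ i) x) ` {0..<?l}" for i
      using l by (intro image_eqI[of _ _ "i mod ?l"]) (simp_all add: funpow_mod_eq)
    show ?thesis
      unfolding orbit_altdef_permutation[OF assms] using * by blast
  qed
  moreover have "inj_on (\<lambda>i. (p ^^ i) x) {0..<?l}"
    using cycle_of_permutation[OF assms, of x] by (simp add: distinct_map)
  ultimately show ?thesis by (simp add: card_image)
qed

text \<open>For \<open>a \<le> b\<close>, cancelling the injective \<open>p ^^ a\<close> leaves the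
  condition that \<open>p ^^ (b - a)\<close> fixes \<open>x\<close>, that is, that the cycle length
  divides \<open>b - a\<close>.\<close>

lemma funpow_eq_iff_card_orbit:
  assumes "permutation p"
  shows "(p ^^ a) x = (p ^^ b) x \<longleftrightarrow> a mod card (orbit p x) = b mod card (orbit p x)"
proof -
  have *: "(p ^^ a) x = (p ^^ b) x \<longleftrightarrow> a mod card (orbit p x) = b mod card (orbit p x)"
    if "a \<le> b" for a b
  proof -
    have inj: "inj (p ^^ a)"
      using assms by (simp add: bij_fn permutation_bijective bij_is_inj)
    have "(p ^^ b) x = (p ^^ a) ((p ^^ (b - a)) x)"
      using that by (metis add.commute comp_apply funpow_add le_add_diff_inverse2)
    then have "(p ^^ a) x = (p ^^ b) x \<longleftrightarrow> (p ^^ (b - a)) x = x"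
      using inj by (metis injD)
    also have "\<dots> \<longleftrightarrow> card (orbit p x) dvd b - a"
      using least_power_dvd[OF assms] card_orbit_eq_least_power[OF assms] by metis
    also have "\<dots> \<longleftrightarrow> b mod card (orbit p x) = a mod card (orbit p x)"
      using mod_eq_dvd_iff_nat[OF that] by blast
    finally show ?thesis by metis
  qed
  show ?thesis using *[of a b] *[of b a] by (metis linear)
qed

text \<open>The cycles of length \<open>i\<close> are disjoint, have \<open>i\<close> points each,
  and together consist of exactly the points counted here.\<close>

lemma card_orbit_size:
  assumes "\<pi> permutes {1..n}"
  shows "card {x\<in>{1..n}. card (orbit \<pi> x) = i} = i * num_cycles n \<pi> i"
proof -
  have perm: "permutation \<pi>"
    using assms by (auto simp: permutation_permutes)
  have orbit_eq: "orbit \<pi> z = orbit \<pi> y" if "z \<in> orbit \<pi> y" for y z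
    using orbit_cyclic_eq3[OF cyclic_on_orbit'[OF perm] that] .
  let ?C = "{C \<in> orbit \<pi> ` {1..n}. card C = i}"
  have "{x\<in>{1..n}. card (orbit \<pi> x) = i} = \<Union>?C"
  proof (intro set_eqI iffI)
    fix x assume "x \<in> {x\<in>{1..n}. card (orbit \<pi> x) = i}"
    then show "x \<in> \<Union>?C" using permutation_self_in_orbit[OF perm, of x] by blast
  next
    fix x assume "x \<in> \<Union>?C"
    then obtain y where y: "y \<in> {1..n}" "card (orbit \<pi> y) = i" "x \<in> orbit \<pi> y" by blast
    have "orbit \<pi> x = orbit \<pi> y"
      using orbit_eq y(3) by blast
    moreover have "x \<in> {1..n}"
      using permutes_orbit_subset[OF assms y(1)] y(3) by blast
    ultimately show "x \<in> {x\<in>{1..n}. card (orbit \<pi> x) = i}" using y by simp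
  qed
  also have "card (\<Union>?C) = (\<Sum>C\<in>?C. card C)"
  proof (rule card_Union_disjoint)
    show "pairwise disjnt ?C"
    proof (intro pairwiseI)
      fix A B assume A: "A \<in> ?C" and B: "B \<in> ?C" and "A \<noteq> B"
      then obtain a b where ab: "A = orbit \<pi> a" "B = orbit \<pi> b" by blast
      show "disjnt A B"
      proof (rule ccontr)
        assume "\<not> disjnt A B"
        then obtain z where "z \<in> A" "z \<in> B" by (auto simp: disjnt_def)
        then have "orbit \<pi> z = A" "orbit \<pi> z = B"
          using ab orbit_eq[of z a] orbit_eq[of z b] by auto
        with \<open>A \<noteq> B\<close> show False by simp
      qed
    qed
    fix C assume "C \<in> ?C"
    then obtain x where "x \<in> {1..n}" "C = orbit \<pi> x" by blast
    then show "finite C"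
      using permutes_orbit_subset[OF assms] finite_subset by blast
  qed
  also have "\<dots> = i * num_cycles n \<pi> i"
    by (simp add: num_cycles_def)
  finally show ?thesis .
qed


section \<open>Systems of equations between iterates of unknown points\<close>

text \<open>A pair \<open>(v, p)\<close> is a formal term, the p-th iterate applied to the unknown
  \<open>v\<close>. Since terms are formal, a system of equations is one fixed set of pairs, and its
  number of solutions is a function of n and \<pi>.\<close>

definition term_val :: "(nat \<Rightarrow> nat) \<Rightarrow> ('v \<Rightarrow> nat) \<Rightarrow> 'v \<times> nat \<Rightarrow> nat" where
  "term_val \<pi> x t = (\<pi> ^^ snd t) (x (fst t))"

definition solutions ::
    "'v set \<Rightarrow> (('v \<times> nat) \<times> ('v \<times> nat)) set \<Rightarrow> nat \<Rightarrow> (nat \<Rightarrow> nat) \<Rightarrow> ('v \<Rightarrow> nat) set" where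
  "solutions V E n \<pi> =
     {x \<in> V \<rightarrow>\<^sub>E {1..n}. \<forall>s t. (s, t) \<in> E \<longrightarrow> term_val \<pi> x s = term_val \<pi> x t}"

lemma solutionsD:
  "x \<in> solutions V E n \<pi> \<Longrightarrow> (s, t) \<in> E \<Longrightarrow> term_val \<pi> x s = term_val \<pi> x t"
  unfolding solutions_def by blast

lemma finite_solutions: "finite V \<Longrightarrow> finite (solutions V E n \<pi>)"
  unfolding solutions_def by (rule finite_subset[of _ "V \<rightarrow>\<^sub>E {1..n}"]) (auto intro: finite_PiE)

lemma permutes_permutation: "\<pi> permutes {1..n::nat} \<Longrightarrow> permutation \<pi>"
  by (auto simp: permutation_permutes)

text \<open>Whether \<open>x\<close> is counted depends only on the length of its cycle. If all
  equations are trivial, the count is n, of degree 1 \<le> \<open>w\<close>. Otherwise only the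
  lengths in \<open>?G\<close> are possible, and each \<open>i\<close> in it contributes i times the
  number of i-cycles, of degree i \<le> \<open>w\<close>.\<close>

lemma cycle_poly_single_variable:
  fixes P :: "(nat \<times> nat) set"
  assumes "w \<ge> 1" "P \<subseteq> {0..w} \<times> {0..w}"
  shows "cycle_poly w (\<lambda>n \<pi>. of_nat (card {x\<in>{1..n}. \<forall>p q. (p, q) \<in> P \<longrightarrow> (\<pi> ^^ p) x = (\<pi> ^^ q) x}))"
proof (cases "\<forall>p q. (p, q) \<in> P \<longrightarrow> p = q")
  case True
  have "cycle_poly w (\<lambda>n \<pi>. var_value n \<pi> VarN)"
    by (rule cycle_poly_var) (use assms in auto)
  then show ?thesis
  proof (rule cycle_poly_cong)
    fix n :: nat and \<pi> :: "nat \<Rightarrow> nat"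
    have "{x\<in>{1..n}. \<forall>p q. (p, q) \<in> P \<longrightarrow> (\<pi> ^^ p) x = (\<pi> ^^ q) x} = {1..n}"
      using True by auto
    then show "of_nat (card {x\<in>{1..n}. \<forall>p q. (p, q) \<in> P \<longrightarrow> (\<pi> ^^ p) x = (\<pi> ^^ q) x}) =
        var_value n \<pi> VarN" by simp
  qed
next
  case False
  then obtain p0 q0 where pq: "(p0, q0) \<in> P" "p0 \<noteq> q0" by blast
  with assms(2) have w: "p0 \<le> w" "q0 \<le> w" by auto
  let ?G = "{i\<in>{1..w}. \<forall>p q. (p, q) \<in> P \<longrightarrow> p mod i = q mod i}"
  have "cycle_poly w (\<lambda>n \<pi>. \<Sum>i\<in>?G. of_nat i * var_value n \<pi> (VarM i))"
    by (intro cycle_poly_sum cycle_poly_cmult cycle_poly_var) auto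
  then show ?thesis
  proof (rule cycle_poly_cong)
    fix n :: nat and \<pi> :: "nat \<Rightarrow> nat" assume \<pi>: "\<pi> permutes {1..n}"
    note perm = permutes_permutation[OF \<pi>]
    \<comment> \<open>For a cycle longer than \<open>w\<close>, the residues of \<open>p0\<close>
      and \<open>q0\<close> would be \<open>p0\<close> and \<open>q0\<close> themselves, which
      differ.\<close>
    have orb: "card (orbit \<pi> x) \<in> {1..w}"
      if "p0 mod card (orbit \<pi> x) = q0 mod card (orbit \<pi> x)" for x
    proof -
      have "card (orbit \<pi> x) > 0"
        using card_orbit_eq_least_power[OF perm] least_power_of_permutation(2)[OF perm] by metis
      moreover have "card (orbit \<pi> x) \<le> w"
      proof (rule ccontr)
        assume "\<not> card (orbit \<pi> x) \<le> w"
        with w that have "p0 = q0" by simp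
        with pq show False by simp
      qed
      ultimately show ?thesis by simp
    qed
    have *: "{x\<in>{1..n}. \<forall>p q. (p, q) \<in> P \<longrightarrow> (\<pi> ^^ p) x = (\<pi> ^^ q) x} =
        (\<Union>i\<in>?G. {x\<in>{1..n}. card (orbit \<pi> x) = i})"
      using orb pq(1) unfolding funpow_eq_iff_card_orbit[OF perm] by auto
    have "card (\<Union>i\<in>?G. {x\<in>{1..n}. card (orbit \<pi> x) = i}) =
        (\<Sum>i\<in>?G. card {x\<in>{1..n}. card (orbit \<pi> x) = i})"
      by (rule card_UN_disjoint) auto
    also have "\<dots> = (\<Sum>i\<in>?G. i * num_cycles n \<pi> i)"
      by (simp only: card_orbit_size[OF \<pi>])
    finally show "of_nat (card {x\<in>{1..n}. \<forall>p q. (p, q) \<in> P \<longrightarrow> (\<pi> ^^ p) x = (\<pi> ^^ q) x}) =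
        (\<Sum>i\<in>?G. of_nat i * var_value n \<pi> (VarM i))"
      unfolding * by simp
  qed
qed

text \<open>
  Given $\pi^p(x_a) = \pi^q(x_b)$ with $q \le p$, the term $\pi^r(x_b)$ equals
  $\pi^{r + (p - q)}(x_a)$.
\<close>

definition merge :: "'v \<Rightarrow> 'v \<Rightarrow> nat \<Rightarrow> 'v \<times> nat \<Rightarrow> 'v \<times> nat" where
  "merge a b c t = (if fst t = b then (a, snd t + c) else t)"

text \<open>The equation determines the value at \<open>b\<close> from the value at
  \<open>a\<close>, so dropping the coordinate \<open>b\<close> loses nothing. Substituting for it
  turns the other equations into their merged forms, while both sides of the equation itself become
  \<open>(a, p)\<close>.\<close>

lemma card_solutions_merge:
  assumes ab: "a \<in> V" "b \<in> V" "a \<noteq> b" and qp: "q \<le> p"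
    and E: "((a, p), (b, q)) \<in> E \<or> ((b, q), (a, p)) \<in> E"
      "E \<subseteq> (V \<times> UNIV) \<times> (V \<times> UNIV)"
    and \<pi>: "\<pi> permutes {1..n}"
  shows "card (solutions V E n \<pi>) =
    card (solutions (V - {b}) (map_prod (merge a b (p - q)) (merge a b (p - q)) ` E) n \<pi>)"
proof (rule bij_betw_same_card)
  let ?c = "p - q"
  let ?m = "merge a b ?c"
  let ?E' = "map_prod ?m ?m ` E"
  let ?r = "\<lambda>x. restrict x (V - {b})"
  let ?e = "\<lambda>y. y(b := (\<pi> ^^ ?c) (y a))"
  \<comment> \<open>A merged term takes the same value without the coordinate \<open>b\<close> as
    the original term takes with it. Both directions of the bijection rest on this.\<close>
  have tv: "term_val \<pi> y (?m t) = term_val \<pi> x t"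
    if "fst t \<in> V" "x b = (\<pi> ^^ ?c) (x a)" "\<And>v. v \<in> V - {b} \<Longrightarrow> y v = x v" for x y t
    using that ab by (auto simp: term_val_def merge_def funpow_add)
  have xb: "x b = (\<pi> ^^ ?c) (x a)" if "x \<in> solutions V E n \<pi>" for x
  proof -
    have "(\<pi> ^^ p) (x a) = (\<pi> ^^ q) (x b)"
      using that E(1) by (fastforce simp: solutions_def term_val_def)
    moreover have "(\<pi> ^^ p) (x a) = (\<pi> ^^ q) ((\<pi> ^^ ?c) (x a))"
      using qp by (metis comp_apply funpow_add le_add_diff_inverse)
    moreover have "inj (\<pi> ^^ q)"
      using \<pi> by (simp add: inj_fn permutes_inj)
    ultimately show ?thesis by (metis injD)
  qed
  show "bij_betw ?r (solutions V E n \<pi>) (solutions (V - {b}) ?E' n \<pi>)"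
  proof (rule bij_betw_byWitness[where f' = ?e])
    show "\<forall>x\<in>solutions V E n \<pi>. ?e (?r x) = x"
    proof
      fix x assume x: "x \<in> solutions V E n \<pi>"
      have "x \<in> extensional V" using x by (auto simp: solutions_def PiE_def)
      then show "?e (?r x) = x"
        using xb[OF x] ab by (auto simp: fun_eq_iff restrict_def extensional_def)
    qed
    show "\<forall>y\<in>solutions (V - {b}) ?E' n \<pi>. ?r (?e y) = y"
      by (auto simp: fun_eq_iff restrict_def solutions_def PiE_def extensional_def)
    show "?r ` solutions V E n \<pi> \<subseteq> solutions (V - {b}) ?E' n \<pi>"
    proof (rule image_subsetI)
      fix x assume x: "x \<in> solutions V E n \<pi>"
      have "term_val \<pi> (?r x) s' = term_val \<pi> (?r x) t'" if "(s', t') \<in> ?E'" for s' t'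
      proof -
        from that obtain s t where st: "(s, t) \<in> E" "s' = ?m s" "t' = ?m t" by auto
        then have V: "fst s \<in> V" "fst t \<in> V" using E(2) by auto
        have "term_val \<pi> x s = term_val \<pi> x t" using solutionsD[OF x st(1)] .
        then show ?thesis
          unfolding st(2,3) using tv[OF V(1) xb[OF x]] tv[OF V(2) xb[OF x]] by simp
      qed
      then show "?r x \<in> solutions (V - {b}) ?E' n \<pi>"
        using x by (auto simp: solutions_def)
    qed
    show "?e ` solutions (V - {b}) ?E' n \<pi> \<subseteq> solutions V E n \<pi>"
    proof (rule image_subsetI)
      fix y assume y: "y \<in> solutions (V - {b}) ?E' n \<pi>"
      have "term_val \<pi> (?e y) s = term_val \<pi> (?e y) t" if st: "(s, t) \<in> E" for s t
      proof -
        have V: "fst s \<in> V" "fst t \<in> V" using st E(2) by auto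
        have "term_val \<pi> y (?m s) = term_val \<pi> y (?m t)"
          using solutionsD[OF y map_prod_imageI[OF st, of ?m ?m]] .
        moreover have "term_val \<pi> y (?m u) = term_val \<pi> (?e y) u" if "fst u \<in> V" for u
          by (rule tv[OF that]) (use ab in auto)
        ultimately show ?thesis using V by simp
      qed
      moreover have "(\<pi> ^^ ?c) (y a) \<in> {1..n}"
      proof -
        have "y \<in> (V - {b}) \<rightarrow>\<^sub>E {1..n}" using y by (simp add: solutions_def)
        then have "y a \<in> {1..n}" by (rule PiE_mem) (use ab in auto)
        then show ?thesis
          using permutes_in_image[OF permutes_funpow[OF \<pi>]] by blast
      qed
      then have "?e y \<in> V \<rightarrow>\<^sub>E {1..n}"
        using y ab by (auto simp: solutions_def PiE_def extensional_def Pi_def)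
      ultimately show "?e y \<in> solutions V E n \<pi>"
        by (simp add: solutions_def)
    qed
  qed
qed

text \<open>
  The weight of a variable bounds both the exponents applied to it and its contribution to the
  degree. Merging \<open>b\<close> into \<open>a\<close> adds the weights, which keeps the exponents bounded
  (\<open>p \<le> w a\<close> and \<open>r \<le> w b\<close> give \<open>r + (p - q) \<le> w a + w b\<close>) and the total weight constant.
\<close>

lemma cycle_poly_solutions:
  fixes V :: "'v set"
  assumes "finite V" "\<And>v. v \<in> V \<Longrightarrow> w v \<ge> 1"
    "E \<subseteq> (SIGMA v:V. {0..w v}) \<times> (SIGMA v:V. {0..w v})"
  shows "cycle_poly (\<Sum>v\<in>V. w v) (\<lambda>n \<pi>. of_nat (card (solutions V E n \<pi>)))"
  using assms
proof (induction "card V" arbitrary: V w E rule: less_induct)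
  case less
  show ?case
  proof (cases "\<exists>s t. ((s, t) \<in> E \<or> (t, s) \<in> E) \<and> fst s \<noteq> fst t")
    case True
    \<comment> \<open>By symmetry, the side with the larger exponent is the one called
      \<open>(a, p)\<close>.\<close>
    then obtain a p b q where
      E: "((a, p), (b, q)) \<in> E \<or> ((b, q), (a, p)) \<in> E" "a \<noteq> b" "q \<le> p"
      by (metis linear prod.collapse)
    have bounds: "a \<in> V" "b \<in> V" "p \<le> w a" "q \<le> w b"
      using E(1) less.prems(3) by auto
    let ?w = "w(a := w a + w b)"
    let ?m = "merge a b (p - q)"
    have m: "?m t \<in> (SIGMA v:V - {b}. {0..?w v})" if "t \<in> (SIGMA v:V. {0..w v})" for t
      using that bounds E(2,3) by (auto simp: merge_def)
    have "cycle_poly (\<Sum>v\<in>V - {b}. ?w v)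
        (\<lambda>n \<pi>. of_nat (card (solutions (V - {b}) (map_prod ?m ?m ` E) n \<pi>)))"
    proof (rule less.hyps)
      show "card (V - {b}) < card V"
        using less.prems(1) bounds by (intro psubset_card_mono) auto
      show "map_prod ?m ?m ` E \<subseteq> (SIGMA v:V - {b}. {0..?w v}) \<times> (SIGMA v:V - {b}. {0..?w v})"
      proof (rule image_subsetI)
        fix st assume "st \<in> E"
        then show "map_prod ?m ?m st \<in> (SIGMA v:V - {b}. {0..?w v}) \<times> (SIGMA v:V - {b}. {0..?w v})"
          using m[of "fst st"] m[of "snd st"] less.prems(3) by (cases st) auto
      qed
      show "1 \<le> ?w v" if "v \<in> V - {b}" for v
        using that less.prems(2)[of v] by auto
    qed (use less.prems in auto)
    moreover have "(\<Sum>v\<in>V - {b}. ?w v) = (\<Sum>v\<in>V. w v)"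
    proof -
      have "(\<Sum>v\<in>V. w v) = w b + (w a + (\<Sum>v\<in>V - {b} - {a}. w v))"
        using less.prems(1) bounds E(2) sum.remove[of V b w] sum.remove[of "V - {b}" a w] by simp
      moreover have "(\<Sum>v\<in>V - {b}. ?w v) = ?w a + (\<Sum>v\<in>V - {b} - {a}. ?w v)"
        using less.prems(1) bounds E(2) by (intro sum.remove) auto
      moreover have "(\<Sum>v\<in>V - {b} - {a}. ?w v) = (\<Sum>v\<in>V - {b} - {a}. w v)"
        by (rule sum.cong) auto
      ultimately show ?thesis by simp
    qed
    ultimately have *: "cycle_poly (\<Sum>v\<in>V. w v)
        (\<lambda>n \<pi>. of_nat (card (solutions (V - {b}) (map_prod ?m ?m ` E) n \<pi>)))" by simp
    have E_sub: "E \<subseteq> (V \<times> UNIV) \<times> (V \<times> UNIV)" using less.prems(3) by auto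
    show ?thesis
      by (rule cycle_poly_cong[OF *])
        (use card_solutions_merge[OF bounds(1,2) E(2,3,1) E_sub] in simp)
  next
    case False
    \<comment> \<open>Each equation now involves a single variable, so the solution set is a product
      over the variables.\<close>
    let ?P = "\<lambda>v. {(p, q). ((v, p), (v, q)) \<in> E}"
    let ?S = "\<lambda>v n \<pi>. {x\<in>{1..n}. \<forall>p q. (p, q) \<in> ?P v \<longrightarrow> (\<pi> ^^ p) x = (\<pi> ^^ q) x}"
    have "cycle_poly (\<Sum>v\<in>V. w v) (\<lambda>n \<pi>. \<Prod>v\<in>V. of_nat (card (?S v n \<pi>)))"
    proof (intro cycle_poly_prod cycle_poly_single_variable)
      fix v assume "v \<in> V"
      then show "1 \<le> w v" by (rule less.prems(2))
      show "?P v \<subseteq> {0..w v} \<times> {0..w v}" using less.prems(3) by auto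
    qed
    then show ?thesis
    proof (rule cycle_poly_cong)
      fix n :: nat and \<pi> :: "nat \<Rightarrow> nat"
      have "solutions V E n \<pi> = (\<Pi>\<^sub>E v\<in>V. ?S v n \<pi>)"
      proof (intro set_eqI iffI)
        fix x assume x: "x \<in> solutions V E n \<pi>"
        have "(\<pi> ^^ p) (x v) = (\<pi> ^^ q) (x v)" if "((v, p), (v, q)) \<in> E" for v p q
          using solutionsD[OF x that] by (simp add: term_val_def)
        then show "x \<in> (\<Pi>\<^sub>E v\<in>V. ?S v n \<pi>)"
          using x by (auto simp: solutions_def PiE_iff)
      next
        fix x assume x: "x \<in> (\<Pi>\<^sub>E v\<in>V. ?S v n \<pi>)"
        have "term_val \<pi> x s = term_val \<pi> x t" if "(s, t) \<in> E" for s t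
        proof -
          have "fst s = fst t" using that False by blast
          moreover have "fst s \<in> V" using that less.prems(3) by auto
          moreover from calculation(1) have "((fst s, snd s), (fst s, snd t)) \<in> E"
            using that by (metis prod.collapse)
          ultimately show ?thesis using x
            by (auto simp: term_val_def PiE_iff)
        qed
        then show "x \<in> solutions V E n \<pi>" using x by (auto simp: solutions_def PiE_iff)
      qed
      then show "of_nat (card (solutions V E n \<pi>)) = (\<Prod>v\<in>V. of_nat (card (?S v n \<pi>)) :: rat)"
        by (simp add: card_PiE less.prems(1))
    qed
  qed
qed

section \<open>Assignments with prescribed coincidences\<close>

text \<open>Inclusion-exclusion, one inequation at a time: the assignments violating it are those
  that satisfy \<open>E\<close> enlarged by the corresponding equation, which is why
  \<open>E\<close> varies in the induction. Exponents at most 1 allow every variable the weight 1,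
  whence the degree \<open>card V\<close>.\<close>

lemma cycle_poly_solutions_except:
  fixes V :: "'v set"
  assumes "finite V" "finite F"
    "E \<subseteq> (V \<times> {0..1}) \<times> (V \<times> {0..1})" "F \<subseteq> (V \<times> {0..1}) \<times> (V \<times> {0..1})"
  shows "cycle_poly (card V) (\<lambda>n \<pi>. of_nat (card {x \<in> solutions V E n \<pi>.
    \<forall>s t. (s, t) \<in> F \<longrightarrow> term_val \<pi> x s \<noteq> term_val \<pi> x t}))"
  using assms(2,4,3)
proof (induction F arbitrary: E rule: finite_induct)
  case empty
  then show ?case
    using cycle_poly_solutions[of V "\<lambda>_. 1" E] assms(1) by simp
next
  case (insert e F)
  obtain s0 t0 where e: "e = (s0, t0)" by (cases e)
  let ?N = "\<lambda>E n \<pi>. {x \<in> solutions V E n \<pi>.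
    \<forall>s t. (s, t) \<in> F \<longrightarrow> term_val \<pi> x s \<noteq> term_val \<pi> x t}"
  have "cycle_poly (card V)
      (\<lambda>n \<pi>. of_nat (card (?N E n \<pi>)) - of_nat (card (?N (insert e E) n \<pi>)))"
    by (intro cycle_poly_diff insert.IH) (use insert.prems in auto)
  then show ?case
  proof (rule cycle_poly_cong)
    fix n :: nat and \<pi> :: "nat \<Rightarrow> nat"
    let ?M = "{x \<in> solutions V E n \<pi>.
      \<forall>s t. (s, t) \<in> insert e F \<longrightarrow> term_val \<pi> x s \<noteq> term_val \<pi> x t}"
    have "solutions V (insert e E) n \<pi> =
        {x \<in> solutions V E n \<pi>. term_val \<pi> x s0 = term_val \<pi> x t0}"
      unfolding solutions_def e by blast
    then have N: "?N (insert e E) n \<pi> = {x \<in> ?N E n \<pi>. term_val \<pi> x s0 = term_val \<pi> x t0}"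
      by blast
    have M: "?M = {x \<in> ?N E n \<pi>. term_val \<pi> x s0 \<noteq> term_val \<pi> x t0}"
      unfolding e by blast
    have "?N E n \<pi> = ?M \<union> ?N (insert e E) n \<pi>" "?M \<inter> ?N (insert e E) n \<pi> = {}"
      unfolding N M by blast+
    moreover have "finite ?M" "finite (?N (insert e E) n \<pi>)"
      using finite_solutions[OF assms(1)] by auto
    ultimately have "card (?N E n \<pi>) = card ?M + card (?N (insert e E) n \<pi>)"
      by (simp add: card_Un_disjoint)
    then show "of_nat (card ?M) =
        (of_nat (card (?N E n \<pi>)) - of_nat (card (?N (insert e E) n \<pi>)) :: rat)" by simp
  qed
qed

text \<open>The coincidences of \<open>z\<close>, recorded as a relation that forgets the values. On
  a finite \<open>I\<close> only finitely many relations can arise, whatever n is.\<close>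

definition equality_kernel :: "'s set \<Rightarrow> ('s \<Rightarrow> 'b) \<Rightarrow> ('s \<times> 's) set" where
  "equality_kernel I z = {(s, t) \<in> I \<times> I. z s = z t}"

text \<open>Pairs in \<open>\<kappa>\<close> become equations and all other pairs inequations. A
  relation that is not a kernel has count 0, so a later sum may range over all relations.\<close>

lemma cycle_poly_kernel:
  fixes V :: "'v set"
  assumes "finite V" "\<kappa> \<subseteq> (V \<times> {0..1}) \<times> (V \<times> {0..1})"
  shows "cycle_poly (card V) (\<lambda>n \<pi>. of_nat (card
    {x \<in> V \<rightarrow>\<^sub>E {1..n}. equality_kernel (V \<times> {0..1}) (term_val \<pi> x) = \<kappa>}))"
proof -
  let ?I = "V \<times> {0..1::nat}"
  have "cycle_poly (card V) (\<lambda>n \<pi>. of_nat (card {x \<in> solutions V \<kappa> n \<pi>.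
      \<forall>s t. (s, t) \<in> ?I \<times> ?I - \<kappa> \<longrightarrow> term_val \<pi> x s \<noteq> term_val \<pi> x t}))"
    by (rule cycle_poly_solutions_except) (use assms in auto)
  moreover have "{x \<in> V \<rightarrow>\<^sub>E {1..n}. equality_kernel ?I (term_val \<pi> x) = \<kappa>} = {x \<in> solutions V \<kappa> n \<pi>.
      \<forall>s t. (s, t) \<in> ?I \<times> ?I - \<kappa> \<longrightarrow> term_val \<pi> x s \<noteq> term_val \<pi> x t}" for n \<pi>
    unfolding solutions_def equality_kernel_def using assms(2) by blast
  ultimately show ?thesis by simp
qed

section \<open>Relative order under a random permutation\<close>

text \<open>Comparing each pair in both directions also fixes ties. Values outside \<open>I\<close>
  cannot influence \<open>\<Phi>\<close>, so functions may be restricted to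
  \<open>I\<close>.\<close>

definition order_invariant :: "'s set \<Rightarrow> (('s \<Rightarrow> nat) \<Rightarrow> bool) \<Rightarrow> bool" where
  "order_invariant I \<Phi> \<longleftrightarrow>
     (\<forall>y y'. (\<forall>s\<in>I. \<forall>t\<in>I. y s < y t \<longleftrightarrow> y' s < y' t) \<longrightarrow> \<Phi> y = \<Phi> y')"

lemma order_invariantD:
  assumes "order_invariant I \<Phi>" "\<And>s t. s \<in> I \<Longrightarrow> t \<in> I \<Longrightarrow> y s < y t \<longleftrightarrow> y' s < y' t"
  shows "\<Phi> y = \<Phi> y'"
  using assms unfolding order_invariant_def by blast

text \<open>
  For the kernel \<open>\<kappa>\<close> of a function with \<open>m\<close> values, the rankings are the \<open>m!\<close> ways of ordering
  the classes of \<open>\<kappa>\<close>, restricted to those that satisfy \<open>\<Phi>\<close>.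
\<close>

definition rankings ::
    "'s set \<Rightarrow> (('s \<Rightarrow> nat) \<Rightarrow> bool) \<Rightarrow> ('s \<times> 's) set \<Rightarrow> nat \<Rightarrow> ('s \<Rightarrow> nat) set" where
  "rankings I \<Phi> \<kappa> m = {y \<in> I \<rightarrow>\<^sub>E {..<m}. y ` I = {..<m} \<and> equality_kernel I y = \<kappa> \<and> \<Phi> y}"

text \<open>The probability that a uniformly random order of the classes of \<open>\<kappa>\<close>
  satisfies \<open>\<Phi>\<close>. Here \<open>m\<close> is the number of classes, computed from
  \<open>\<kappa>\<close> alone, so that the value is a constant independent of n and \<pi>.\<close>

definition ranking_probability ::
    "'s set \<Rightarrow> (('s \<Rightarrow> nat) \<Rightarrow> bool) \<Rightarrow> ('s \<times> 's) set \<Rightarrow> rat" where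
  "ranking_probability I \<Phi> \<kappa> =
     (let m = card ((\<lambda>s. \<kappa> `` {s}) ` I) in of_nat (card (rankings I \<Phi> \<kappa> m)) / fact m)"

lemma card_kernel_classes: "card ((\<lambda>s. equality_kernel I z `` {s}) ` I) = card (z ` I)"
proof -
  have "(\<lambda>s. equality_kernel I z `` {s}) ` I = (\<lambda>v. {t\<in>I. z t = v}) ` (z ` I)"
    unfolding image_image by (rule image_cong) (auto simp: equality_kernel_def)
  moreover have "inj_on (\<lambda>v. {t\<in>I. z t = v}) (z ` I)"
    by (rule inj_onI) blast
  ultimately show ?thesis by (simp add: card_image)
qed

text \<open>Once \<open>\<gamma>\<close> numbers the values of \<open>z\<close>, permuting these
  values amounts to ordering the classes of the kernel.\<close>

lemma bij_betw_permutations_rankings: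
  fixes z :: "'s \<Rightarrow> nat"
  assumes I: "finite I" and \<Phi>: "order_invariant I \<Phi>"
    and \<gamma>: "bij_betw \<gamma> (z ` I) {..<m}"
  shows "bij_betw (\<lambda>\<rho>. restrict (\<gamma> \<circ> \<rho> \<circ> z) I)
    {\<rho>. \<rho> permutes (z ` I) \<and> \<Phi> (\<gamma> \<circ> \<rho> \<circ> z)} (rankings I \<Phi> (equality_kernel I z) m)"
proof (rule bij_betwI')
  let ?R = "z ` I"
  fix \<rho> \<rho>' assume "\<rho> \<in> {\<rho>. \<rho> permutes ?R \<and> \<Phi> (\<gamma> \<circ> \<rho> \<circ> z)}"
    "\<rho>' \<in> {\<rho>. \<rho> permutes ?R \<and> \<Phi> (\<gamma> \<circ> \<rho> \<circ> z)}"
  then have \<rho>: "\<rho> permutes ?R" "\<rho>' permutes ?R" by auto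
  show "restrict (\<gamma> \<circ> \<rho> \<circ> z) I = restrict (\<gamma> \<circ> \<rho>' \<circ> z) I \<longleftrightarrow> \<rho> = \<rho>'"
  proof
    assume eq: "restrict (\<gamma> \<circ> \<rho> \<circ> z) I = restrict (\<gamma> \<circ> \<rho>' \<circ> z) I"
    show "\<rho> = \<rho>'"
    proof
      fix r show "\<rho> r = \<rho>' r"
      proof (cases "r \<in> ?R")
        case True
        then obtain s where "s \<in> I" "r = z s" by blast
        then have "\<gamma> (\<rho> r) = \<gamma> (\<rho>' r)" using fun_cong[OF eq, of s] by simp
        moreover have "\<rho> r \<in> ?R" "\<rho>' r \<in> ?R"
          using permutes_in_image[OF \<rho>(1), of r] permutes_in_image[OF \<rho>(2), of r] True by blast+
        ultimately show ?thesis using bij_betw_imp_inj_on[OF \<gamma>] by (meson inj_onD)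
      qed (use \<rho> permutes_not_in in metis)
    qed
  qed simp
next
  let ?R = "z ` I"
  fix \<rho> assume "\<rho> \<in> {\<rho>. \<rho> permutes ?R \<and> \<Phi> (\<gamma> \<circ> \<rho> \<circ> z)}"
  then have \<rho>: "\<rho> permutes ?R" "\<Phi> (\<gamma> \<circ> \<rho> \<circ> z)" by auto
  let ?y = "restrict (\<gamma> \<circ> \<rho> \<circ> z) I"
  have bij: "bij_betw (\<gamma> \<circ> \<rho>) ?R {..<m}"
    using bij_betw_trans[OF permutes_imp_bij[OF \<rho>(1)] \<gamma>] .
  have "?y ` I = (\<gamma> \<circ> \<rho>) ` ?R" by (auto simp: image_iff)
  also have "\<dots> = {..<m}" by (rule bij_betw_imp_surj_on[OF bij])
  finally have im: "?y ` I = {..<m}" .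
  moreover have "?y \<in> I \<rightarrow>\<^sub>E {..<m}" using im by fastforce
  moreover have "equality_kernel I ?y = equality_kernel I z"
    using inj_on_eq_iff[OF bij_betw_imp_inj_on[OF bij]] by (auto simp: equality_kernel_def)
  \<comment> \<open>By order invariance, restriction to \<open>I\<close> does not affect
    \<open>\<Phi>\<close>.\<close>
  moreover have "\<Phi> ?y"
    using order_invariantD[OF \<Phi>, of "\<gamma> \<circ> \<rho> \<circ> z" ?y] \<rho>(2) by simp
  ultimately show "?y \<in> rankings I \<Phi> (equality_kernel I z) m"
    by (simp add: rankings_def)
next
  let ?R = "z ` I"
  fix y assume "y \<in> rankings I \<Phi> (equality_kernel I z) m"
  then have y: "y \<in> I \<rightarrow>\<^sub>E {..<m}" "y ` I = {..<m}" "equality_kernel I y = equality_kernel I z" "\<Phi> y"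
    by (auto simp: rankings_def)
  have y_eq: "y s = y t \<longleftrightarrow> z s = z t" if "s \<in> I" "t \<in> I" for s t
    using y(3) that unfolding equality_kernel_def by blast
  \<comment> \<open>Since \<open>y\<close> and \<open>z\<close> have the same kernel,
    \<open>y\<close> factors through \<open>z\<close> as \<open>?\<beta> \<circ> z\<close> on
    \<open>I\<close>, whichever preimages \<open>inv_into\<close> picks. Solving
    \<open>\<gamma> \<circ> \<rho> = ?\<beta>\<close> on the values of \<open>z\<close> gives
    \<open>?\<rho>\<close>, extended by the identity.\<close>
  let ?\<beta> = "y \<circ> inv_into I z"
  let ?\<rho> = "\<lambda>r. if r \<in> ?R then (inv_into ?R \<gamma> \<circ> ?\<beta>) r else r"
  have \<beta>: "?\<beta> (z s) = y s" if "s \<in> I" for s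
    using y_eq[of "inv_into I z (z s)" s] that by (simp add: inv_into_into f_inv_into_f)
  have "bij_betw ?\<beta> ?R {..<m}"
    unfolding bij_betw_def
  proof
    show "inj_on ?\<beta> ?R"
      using \<beta> y_eq by (auto intro!: inj_onI)
    have "?\<beta> ` ?R = y ` I" unfolding image_image by (rule image_cong[OF refl \<beta>])
    then show "?\<beta> ` ?R = {..<m}" using y(2) by simp
  qed
  then have "bij_betw (inv_into ?R \<gamma> \<circ> ?\<beta>) ?R ?R"
    using bij_betw_trans bij_betw_inv_into[OF \<gamma>] by blast
  then have "bij_betw ?\<rho> ?R ?R"
    by (subst bij_betw_cong[of ?R ?\<rho> "inv_into ?R \<gamma> \<circ> ?\<beta>"]) auto
  then have \<rho>: "?\<rho> permutes ?R"
    by (rule bij_imp_permutes) simp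
  have \<gamma>\<rho>: "(\<gamma> \<circ> ?\<rho> \<circ> z) s = y s" if "s \<in> I" for s
  proof -
    have "?\<rho> (z s) = inv_into ?R \<gamma> (y s)" using \<beta>[OF that] that by simp
    moreover have "\<gamma> (inv_into ?R \<gamma> (y s)) = y s"
      by (rule f_inv_into_f) (use that y(2) bij_betw_imp_surj_on[OF \<gamma>] in blast)
    ultimately show ?thesis by simp
  qed
  have "\<Phi> (\<gamma> \<circ> ?\<rho> \<circ> z)"
    using order_invariantD[OF \<Phi>, of "\<gamma> \<circ> ?\<rho> \<circ> z" y] \<gamma>\<rho> y(4) by simp
  moreover have "y = restrict (\<gamma> \<circ> ?\<rho> \<circ> z) I"
  proof
    fix s show "y s = restrict (\<gamma> \<circ> ?\<rho> \<circ> z) I s"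
      using \<gamma>\<rho>[of s] y(1) by (cases "s \<in> I") (auto simp: PiE_def extensional_def)
  qed
  ultimately show "\<exists>\<rho>\<in>{\<rho>. \<rho> permutes ?R \<and> \<Phi> (\<gamma> \<circ> \<rho> \<circ> z)}. y = restrict (\<gamma> \<circ> \<rho> \<circ> z) I"
    using \<rho> by blast
qed

text \<open>Only the relative order of the values of \<open>\<tau>\<close> matters, so they can be
  replaced by their ranks, which reduces the claim to the preceding bijection. Hence the count is
  the same for every \<open>\<tau>\<close>.\<close>

lemma card_permutations_order_invariant:
  fixes z :: "'s \<Rightarrow> nat"
  assumes I: "finite I" and \<Phi>: "order_invariant I \<Phi>" and \<tau>: "inj_on \<tau> (z ` I)"
  shows "card {\<rho>. \<rho> permutes (z ` I) \<and> \<Phi> (\<tau> \<circ> \<rho> \<circ> z)} =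
    card (rankings I \<Phi> (equality_kernel I z) (card (z ` I)))"
proof -
  let ?R = "z ` I"
  let ?m = "card ?R"
  have "finite (\<tau> ` ?R)" using I by simp
  then obtain h where h: "bij_betw h {..<?m} (\<tau> ` ?R)" "strict_mono_on {..<?m} h"
    using ex_bij_betw_strict_mono_card[of "\<tau> ` ?R"] by (metis card_image[OF \<tau>])
  \<comment> \<open>The inverse of the increasing enumeration sends each value of
    \<open>\<tau>\<close> to its rank and preserves all comparisons.\<close>
  let ?\<theta> = "inv_into {..<?m} h"
  have \<theta>: "?\<theta> u < ?\<theta> v \<longleftrightarrow> u < v" if "u \<in> \<tau> ` ?R" "v \<in> \<tau> ` ?R" for u v
  proof -
    have "?\<theta> u \<in> {..<?m}" "?\<theta> v \<in> {..<?m}" "h (?\<theta> u) = u" "h (?\<theta> v) = v"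
      using that h(1) by (metis bij_betw_imp_surj_on f_inv_into_f inv_into_into)+
    then show ?thesis using strict_mono_on_less[OF h(2)] by metis
  qed
  let ?\<gamma> = "?\<theta> \<circ> \<tau>"
  have \<gamma>: "bij_betw ?\<gamma> ?R {..<?m}"
    using bij_betw_trans[OF inj_on_imp_bij_betw[OF \<tau>] bij_betw_inv_into[OF h(1)]] .
  have "\<Phi> (\<tau> \<circ> \<rho> \<circ> z) = \<Phi> (?\<gamma> \<circ> \<rho> \<circ> z)" if "\<rho> permutes ?R" for \<rho>
  proof (rule order_invariantD[OF \<Phi>])
    fix s t assume "s \<in> I" "t \<in> I"
    then have "\<tau> (\<rho> (z s)) \<in> \<tau> ` ?R" "\<tau> (\<rho> (z t)) \<in> \<tau> ` ?R"
      using permutes_in_image[OF that] by blast+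
    then show "(\<tau> \<circ> \<rho> \<circ> z) s < (\<tau> \<circ> \<rho> \<circ> z) t \<longleftrightarrow> (?\<gamma> \<circ> \<rho> \<circ> z) s < (?\<gamma> \<circ> \<rho> \<circ> z) t"
      using \<theta> by simp
  qed
  then have "{\<rho>. \<rho> permutes ?R \<and> \<Phi> (\<tau> \<circ> \<rho> \<circ> z)} = {\<rho>. \<rho> permutes ?R \<and> \<Phi> (?\<gamma> \<circ> \<rho> \<circ> z)}"
    by blast
  then show ?thesis
    using bij_betw_same_card[OF bij_betw_permutations_rankings[OF I \<Phi> \<gamma>]] by simp
qed

lemma sum_of_bool_card:
  "finite A \<Longrightarrow> (\<Sum>x\<in>A. of_bool (P x)) = (of_nat (card {x \<in> A. P x}) :: rat)"
  by (subst sum_of_bool_eq) (simp_all add: Int_def)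

text \<open>
  Averaging over \<open>\<tau> \<circ> \<rho>\<close>, with \<open>\<rho>\<close> permuting the range of \<open>z\<close>, does not change the average over
  \<open>\<tau>\<close>, and for a fixed \<open>\<tau>\<close> the average over \<open>\<rho>\<close> already is the ranking probability.
\<close>

lemma average_order_invariant:
  fixes z :: "'s \<Rightarrow> nat"
  assumes I: "finite I" and z: "z ` I \<subseteq> {1..n}" and \<Phi>: "order_invariant I \<Phi>"
  shows "(\<Sum>\<tau> | \<tau> permutes {1..n}. of_bool (\<Phi> (\<tau> \<circ> z))) / fact n =
    ranking_probability I \<Phi> (equality_kernel I z)"
proof -
  let ?R = "z ` I"
  let ?m = "card ?R"
  let ?S = "\<Sum>\<tau> | \<tau> permutes {1..n}. of_bool (\<Phi> (\<tau> \<circ> z)) :: rat"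
  let ?Y = "rankings I \<Phi> (equality_kernel I z) ?m"
  have fin: "finite {\<rho>. \<rho> permutes ?R}" using I by (simp add: finite_permutations)
  have "fact ?m * ?S = (\<Sum>\<rho> | \<rho> permutes ?R. ?S)"
    using card_permutations[of ?R ?m] I by simp
  also have "\<dots> = (\<Sum>\<rho> | \<rho> permutes ?R. \<Sum>\<tau> | \<tau> permutes {1..n}. of_bool (\<Phi> (\<tau> \<circ> \<rho> \<circ> z)))"
  proof (rule sum.cong[OF refl])
    fix \<rho> assume "\<rho> \<in> {\<rho>. \<rho> permutes ?R}"
    \<comment> \<open>Being the identity off \<open>?R\<close>, \<open>\<rho>\<close> also belongs
      to the full symmetric group, where right composition with it reindexes the sum over
      \<open>\<tau>\<close>.\<close>
    then have "\<rho> permutes {1..n}" using z permutes_subset by blast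
    from sum_permutations_compose_right[OF this, of "\<lambda>\<tau>. of_bool (\<Phi> (\<tau> \<circ> z)) :: rat"]
    show "?S = (\<Sum>\<tau> | \<tau> permutes {1..n}. of_bool (\<Phi> (\<tau> \<circ> \<rho> \<circ> z)))" .
  qed
  also have "\<dots> = (\<Sum>\<tau> | \<tau> permutes {1..n}. \<Sum>\<rho> | \<rho> permutes ?R. of_bool (\<Phi> (\<tau> \<circ> \<rho> \<circ> z)))"
    by (rule sum.swap)
  also have "\<dots> = (\<Sum>\<tau> | \<tau> permutes {1..n}. of_nat (card ?Y))"
  proof (rule sum.cong[OF refl])
    fix \<tau> assume "\<tau> \<in> {\<tau>. \<tau> permutes {1..n}}"
    then have "inj_on \<tau> ?R" by (simp add: permutes_inj_on)
    from card_permutations_order_invariant[OF I \<Phi> this]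
    show "(\<Sum>\<rho> | \<rho> permutes ?R. of_bool (\<Phi> (\<tau> \<circ> \<rho> \<circ> z))) = (of_nat (card ?Y) :: rat)"
      unfolding sum_of_bool_card[OF fin] by simp
  qed
  also have "\<dots> = fact n * of_nat (card ?Y)"
    using card_permutations[of "{1..n}" n] by simp
  finally show ?thesis
    by (simp add: ranking_probability_def card_kernel_classes field_simps)
qed

section \<open>Averages over conjugates of a permutation\<close>

text \<open>Conjugation relabels points: the inner inverse of \<open>\<tau>\<close> cancels against
  the \<open>\<tau>\<close> applied to \<open>x\<close>. The exponents 0 and 1 stand for a position
  and the value there.\<close>

lemma term_val_conjugate:
  assumes "\<tau> permutes {1..n}" "fst t \<in> V" "snd t \<in> {0..1}"
  shows "term_val (\<tau> \<circ> \<pi> \<circ> inv \<tau>) (restrict (\<tau> \<circ> x) V) t = \<tau> (term_val \<pi> x t)"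
proof -
  have "snd t = 0 \<or> snd t = 1" using assms(3) by auto
  then show ?thesis
    using assms(2) permutes_inverses(2)[OF assms(1)] by (auto simp: term_val_def)
qed

lemma bij_betw_PiE_permutes:
  assumes "\<tau> permutes A"
  shows "bij_betw (\<lambda>x. restrict (\<tau> \<circ> x) V) (V \<rightarrow>\<^sub>E A) (V \<rightarrow>\<^sub>E A)"
proof (rule bij_betw_byWitness[where f' = "\<lambda>x. restrict (inv \<tau> \<circ> x) V"])
  note inverses = permutes_inverses[OF assms]
  show "\<forall>x\<in>V \<rightarrow>\<^sub>E A. restrict (inv \<tau> \<circ> restrict (\<tau> \<circ> x) V) V = x"
    by (auto simp: fun_eq_iff restrict_def PiE_def extensional_def inverses)
  show "\<forall>x\<in>V \<rightarrow>\<^sub>E A. restrict (\<tau> \<circ> restrict (inv \<tau> \<circ> x) V) V = x"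
    by (auto simp: fun_eq_iff restrict_def PiE_def extensional_def inverses)
  show "(\<lambda>x. restrict (\<tau> \<circ> x) V) ` (V \<rightarrow>\<^sub>E A) \<subseteq> V \<rightarrow>\<^sub>E A"
    using permutes_in_image[OF assms] by auto
  show "(\<lambda>x. restrict (inv \<tau> \<circ> x) V) ` (V \<rightarrow>\<^sub>E A) \<subseteq> V \<rightarrow>\<^sub>E A"
    using permutes_in_image[OF permutes_inv[OF assms]] by auto
qed

text \<open>For fixed \<open>x\<close>, the average over \<open>\<tau>\<close> is a ranking
  probability, which depends only on the kernel of the term values. Grouping the assignments by
  kernel leaves a fixed finite sum of constants times polynomial counts.\<close>

lemma cycle_poly_average:
  fixes V :: "'v set"
  assumes V: "finite V" and \<Phi>: "order_invariant (V \<times> {0..1}) \<Phi>"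
  shows "cycle_poly (card V) (\<lambda>n \<pi>. (\<Sum>\<tau> | \<tau> permutes {1..n}.
    \<Sum>x\<in>V \<rightarrow>\<^sub>E {1..n}. of_bool (\<Phi> (term_val (\<tau> \<circ> \<pi> \<circ> inv \<tau>) x))) / fact n)"
proof -
  let ?I = "V \<times> {0..1::nat}"
  let ?k = "\<lambda>\<pi> x. equality_kernel ?I (term_val \<pi> x)"
  have finI: "finite ?I" using V by simp
  have "cycle_poly (card V) (\<lambda>n \<pi>. \<Sum>\<kappa>\<in>Pow (?I \<times> ?I).
      ranking_probability ?I \<Phi> \<kappa> * of_nat (card {x \<in> V \<rightarrow>\<^sub>E {1..n}. ?k \<pi> x = \<kappa>}))"
    by (intro cycle_poly_sum cycle_poly_cmult cycle_poly_kernel V) simp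
  then show ?thesis
  proof (rule cycle_poly_cong)
    fix n :: nat and \<pi> :: "nat \<Rightarrow> nat" assume \<pi>: "\<pi> permutes {1..n}"
    let ?X = "V \<rightarrow>\<^sub>E {1..n}"
    have finX: "finite ?X" using V by (simp add: finite_PiE)
    have "(\<Sum>\<tau> | \<tau> permutes {1..n}. \<Sum>x\<in>?X. of_bool (\<Phi> (term_val (\<tau> \<circ> \<pi> \<circ> inv \<tau>) x)))
        = (\<Sum>\<tau> | \<tau> permutes {1..n}. \<Sum>x\<in>?X. of_bool (\<Phi> (\<tau> \<circ> term_val \<pi> x)) :: rat)"
    proof (rule sum.cong[OF refl])
      fix \<tau> assume "\<tau> \<in> {\<tau>. \<tau> permutes {1..n}}"
      then have \<tau>: "\<tau> permutes {1..n}" by simp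
      \<comment> \<open>Replacing \<open>x\<close> by \<open>\<tau> \<circ> x\<close> permutes the
        assignments and cancels the inverse of \<open>\<tau>\<close> in the conjugate.\<close>
      have "(\<Sum>x\<in>?X. of_bool (\<Phi> (term_val (\<tau> \<circ> \<pi> \<circ> inv \<tau>) x)) :: rat) =
          (\<Sum>x\<in>?X. of_bool (\<Phi> (term_val (\<tau> \<circ> \<pi> \<circ> inv \<tau>) (restrict (\<tau> \<circ> x) V))))"
        by (rule sum.reindex_bij_betw[OF bij_betw_PiE_permutes[OF \<tau>], symmetric])
      also have "\<dots> = (\<Sum>x\<in>?X. of_bool (\<Phi> (\<tau> \<circ> term_val \<pi> x)))"
      proof (rule sum.cong[OF refl])
        fix x
        have "\<Phi> (term_val (\<tau> \<circ> \<pi> \<circ> inv \<tau>) (restrict (\<tau> \<circ> x) V)) = \<Phi> (\<tau> \<circ> term_val \<pi> x)"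
        proof (rule order_invariantD[OF \<Phi>])
          fix s t assume "s \<in> ?I" "t \<in> ?I"
          then have "fst s \<in> V" "snd s \<in> {0..1}" "fst t \<in> V" "snd t \<in> {0..1}" by auto
          then show "term_val (\<tau> \<circ> \<pi> \<circ> inv \<tau>) (restrict (\<tau> \<circ> x) V) s <
              term_val (\<tau> \<circ> \<pi> \<circ> inv \<tau>) (restrict (\<tau> \<circ> x) V) t \<longleftrightarrow>
              (\<tau> \<circ> term_val \<pi> x) s < (\<tau> \<circ> term_val \<pi> x) t"
            using term_val_conjugate[OF \<tau>] by (metis comp_apply)
        qed
        then show "(of_bool (\<Phi> (term_val (\<tau> \<circ> \<pi> \<circ> inv \<tau>) (restrict (\<tau> \<circ> x) V))) :: rat) =
            of_bool (\<Phi> (\<tau> \<circ> term_val \<pi> x))" by simp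
      qed
      finally show "(\<Sum>x\<in>?X. of_bool (\<Phi> (term_val (\<tau> \<circ> \<pi> \<circ> inv \<tau>) x)) :: rat) =
          (\<Sum>x\<in>?X. of_bool (\<Phi> (\<tau> \<circ> term_val \<pi> x)))" .
    qed
    also have "\<dots> = (\<Sum>x\<in>?X. \<Sum>\<tau> | \<tau> permutes {1..n}. of_bool (\<Phi> (\<tau> \<circ> term_val \<pi> x)))"
      by (rule sum.swap)
    finally have "(\<Sum>\<tau> | \<tau> permutes {1..n}. \<Sum>x\<in>?X.
          of_bool (\<Phi> (term_val (\<tau> \<circ> \<pi> \<circ> inv \<tau>) x))) / fact n =
        (\<Sum>x\<in>?X. (\<Sum>\<tau> | \<tau> permutes {1..n}. of_bool (\<Phi> (\<tau> \<circ> term_val \<pi> x))) / fact n :: rat)"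
      by (simp add: sum_divide_distrib)
    also have "\<dots> = (\<Sum>x\<in>?X. ranking_probability ?I \<Phi> (?k \<pi> x))"
    proof (rule sum.cong[OF refl], rule average_order_invariant[OF finI _ \<Phi>])
      fix x assume x: "x \<in> ?X"
      show "term_val \<pi> x ` ?I \<subseteq> {1..n}"
      proof (rule image_subsetI)
        fix t assume "t \<in> ?I"
        then have "x (fst t) \<in> {1..n}" using x by auto
        then show "term_val \<pi> x t \<in> {1..n}"
          unfolding term_val_def using permutes_in_image[OF permutes_funpow[OF \<pi>]] by blast
      qed
    qed
    also have "\<dots> = (\<Sum>\<kappa>\<in>Pow (?I \<times> ?I). \<Sum>x | x \<in> ?X \<and> ?k \<pi> x = \<kappa>.
        ranking_probability ?I \<Phi> (?k \<pi> x))"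
      by (rule sum.group[symmetric]) (use finX finI in \<open>auto simp: equality_kernel_def\<close>)
    also have "\<dots> = (\<Sum>\<kappa>\<in>Pow (?I \<times> ?I).
        ranking_probability ?I \<Phi> \<kappa> * of_nat (card {x \<in> ?X. ?k \<pi> x = \<kappa>}))"
      by (intro sum.cong) (auto simp: mult.commute)
    finally show "(\<Sum>\<tau> | \<tau> permutes {1..n}. \<Sum>x\<in>?X.
          of_bool (\<Phi> (term_val (\<tau> \<circ> \<pi> \<circ> inv \<tau>) x))) / fact n =
        (\<Sum>\<kappa>\<in>Pow (?I \<times> ?I).
          ranking_probability ?I \<Phi> \<kappa> * of_nat (card {x \<in> ?X. ?k \<pi> x = \<kappa>}))" .
  qed
qed

text \<open>
  Averaging over all conjugates of \<open>\<pi>'\<close> permutes the class and gives the same value for each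
  \<open>\<pi>'\<close> in it, which avoids counting centralizers.
\<close>

lemma conj_class_average:
  fixes F :: "(nat \<Rightarrow> nat) \<Rightarrow> rat"
  shows "1 / of_nat (card (conj_class n \<pi>)) * (\<Sum>\<pi>'\<in>conj_class n \<pi>. F \<pi>') =
    (\<Sum>\<tau> | \<tau> permutes {1..n}. F (\<tau> \<circ> \<pi> \<circ> inv \<tau>)) / fact n"
proof -
  let ?S = "{\<tau>. \<tau> permutes {1..n}}"
  let ?C = "conj_class n \<pi>"
  let ?A = "\<lambda>\<pi>. \<Sum>\<tau>\<in>?S. F (\<tau> \<circ> \<pi> \<circ> inv \<tau>)"
  have finS: "finite ?S" by (simp add: finite_permutations)
  have C: "?C = (\<lambda>\<tau>. \<tau> \<circ> \<pi> \<circ> inv \<tau>) ` ?S"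
    by (auto simp: conj_class_def)
  have conj_conj: "\<rho> \<circ> (\<tau> \<circ> \<pi> \<circ> inv \<tau>) \<circ> inv \<rho> = (\<rho> \<circ> \<tau>) \<circ> \<pi> \<circ> inv (\<rho> \<circ> \<tau>)"
    if "\<rho> \<in> ?S" "\<tau> \<in> ?S" for \<rho> \<tau>
    using that by (simp add: o_inv_distrib permutes_bij comp_assoc)
  \<comment> \<open>If \<pi>' is the conjugate of \<pi> by \<open>\<tau>\<close>, then conjugating
    \<pi>' by \<open>\<rho>\<close> is conjugating \<pi> by \<open>\<rho> \<circ> \<tau>\<close>, a
    mere change of the summation index.\<close>
  have A: "?A \<pi>' = ?A \<pi>" if "\<pi>' \<in> ?C" for \<pi>'
  proof -
    from that obtain \<tau> where \<tau>: "\<tau> \<in> ?S" "\<pi>' = \<tau> \<circ> \<pi> \<circ> inv \<tau>" unfolding C by blast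
    have "?A \<pi>' = (\<Sum>\<rho>\<in>?S. F ((\<rho> \<circ> \<tau>) \<circ> \<pi> \<circ> inv (\<rho> \<circ> \<tau>)))"
      unfolding \<tau>(2) by (rule sum.cong[OF refl]) (use conj_conj \<tau>(1) in metis)
    also have "\<dots> = ?A \<pi>"
      using sum_permutations_compose_right[of \<tau> "{1..n}" "\<lambda>\<rho>. F (\<rho> \<circ> \<pi> \<circ> inv \<rho>)"] \<tau>(1) by simp
    finally show ?thesis .
  qed
  have bij: "bij_betw (\<lambda>\<pi>'. \<rho> \<circ> \<pi>' \<circ> inv \<rho>) ?C ?C" if \<rho>: "\<rho> \<in> ?S" for \<rho>
  proof (rule bij_betw_imageI)
    have inv: "inv \<rho> \<circ> \<rho> = id" using \<rho> by (simp add: permutes_inv_o)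
    show "inj_on (\<lambda>\<pi>'. \<rho> \<circ> \<pi>' \<circ> inv \<rho>) ?C"
    proof (rule inj_onI)
      fix p q assume "\<rho> \<circ> p \<circ> inv \<rho> = \<rho> \<circ> q \<circ> inv \<rho>"
      then have "inv \<rho> \<circ> (\<rho> \<circ> p \<circ> inv \<rho>) \<circ> \<rho> = inv \<rho> \<circ> (\<rho> \<circ> q \<circ> inv \<rho>) \<circ> \<rho>" by simp
      moreover have "inv \<rho> \<circ> (\<rho> \<circ> p \<circ> inv \<rho>) \<circ> \<rho> = p" for p
        using inv by (metis comp_assoc comp_id id_comp)
      ultimately show "p = q" by metis
    qed
    have "(\<lambda>\<pi>'. \<rho> \<circ> \<pi>' \<circ> inv \<rho>) ` ?C = (\<lambda>\<tau>. \<tau> \<circ> \<pi> \<circ> inv \<tau>) ` ((\<lambda>\<tau>. \<rho> \<circ> \<tau>) ` ?S)"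
      unfolding C image_image by (rule image_cong[OF refl]) (rule conj_conj[OF \<rho>])
    also have "(\<lambda>\<tau>. \<rho> \<circ> \<tau>) ` ?S = ?S"
      using image_compose_permutations_left[of \<rho> "{1..n}"] \<rho> by (simp add: image_def Collect_conj_eq) blast
    finally show "(\<lambda>\<pi>'. \<rho> \<circ> \<pi>' \<circ> inv \<rho>) ` ?C = ?C" unfolding C .
  qed
  have "fact n * (\<Sum>\<pi>'\<in>?C. F \<pi>') = (\<Sum>\<rho>\<in>?S. \<Sum>\<pi>'\<in>?C. F \<pi>')"
    using card_permutations[of "{1..n}" n] by simp
  also have "\<dots> = (\<Sum>\<rho>\<in>?S. \<Sum>\<pi>'\<in>?C. F (\<rho> \<circ> \<pi>' \<circ> inv \<rho>))"
    by (rule sum.cong[OF refl]) (rule sum.reindex_bij_betw[OF bij, symmetric])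
  also have "\<dots> = (\<Sum>\<pi>'\<in>?C. ?A \<pi>')"
    by (rule sum.swap)
  also have "\<dots> = of_nat (card ?C) * ?A \<pi>"
    using A by simp
  finally have *: "fact n * (\<Sum>\<pi>'\<in>?C. F \<pi>') = of_nat (card ?C) * ?A \<pi>" .
  \<comment> \<open>The class contains \<pi> itself, through the identity, so dividing by its size
    is legitimate.\<close>
  have "card ?C > 0"
    using finS permutes_id[of "{1..n}"] unfolding C card_gt_0_iff by blast
  with * show ?thesis by (simp add: field_simps)
qed

section \<open>Pattern occurrences as order conditions on vectors\<close>

text \<open>The unknown \<open>(j, a)\<close> is the a-th position in an occurrence of the j-th
  pattern. The second index of \<open>z\<close> selects the position (0) or the value of the
  permutation there (1).\<close>

definition pattern_condition ::
    "nat \<Rightarrow> (nat \<Rightarrow> nat) \<Rightarrow> (nat \<Rightarrow> nat \<Rightarrow> nat) \<Rightarrow> ((nat \<times> nat) \<times> nat \<Rightarrow> nat) \<Rightarrow> bool" where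
  "pattern_condition d k \<sigma> z \<longleftrightarrow> (\<forall>j\<in>{1..d}. \<forall>a\<in>{1..k j}. \<forall>b\<in>{1..k j}.
     (a < b \<longrightarrow> z ((j, a), 0) < z ((j, b), 0)) \<and>
     (z ((j, b), 1) < z ((j, a), 1) \<longleftrightarrow> \<sigma> j b < \<sigma> j a))"

lemma order_invariant_pattern_condition:
  "order_invariant ((SIGMA j:{1..d}. {1..k j}) \<times> {0..1}) (pattern_condition d k \<sigma>)"
  unfolding order_invariant_def pattern_condition_def
proof (intro allI impI ball_cong refl)
  fix y y' :: "(nat \<times> nat) \<times> nat \<Rightarrow> nat" and j a b
  assume y: "\<forall>s\<in>(SIGMA j:{1..d}. {1..k j}) \<times> {0..1}. \<forall>t\<in>(SIGMA j:{1..d}. {1..k j}) \<times> {0..1}.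
      (y s < y t) = (y' s < y' t)"
    and j: "j \<in> {1..d}" "a \<in> {1..k j}" "b \<in> {1..k j}"
  have "y ((j, a), i) < y ((j, b), i) \<longleftrightarrow> y' ((j, a), i) < y' ((j, b), i)"
    "y ((j, b), i) < y ((j, a), i) \<longleftrightarrow> y' ((j, b), i) < y' ((j, a), i)" if "i \<in> {0..1}" for i
    by (rule y[rule_format]; use j that in blast)+
  then show "((a < b \<longrightarrow> y ((j, a), 0) < y ((j, b), 0)) \<and>
       (y ((j, b), 1) < y ((j, a), 1)) = (\<sigma> j b < \<sigma> j a)) =
      ((a < b \<longrightarrow> y' ((j, a), 0) < y' ((j, b), 0)) \<and>
       (y' ((j, b), 1) < y' ((j, a), 1)) = (\<sigma> j b < \<sigma> j a))"
    by simp
qed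

text \<open>A choice of one occurrence for every pattern is, by uncurrying, a single vector indexed
  by the disjoint union of the positions.\<close>

lemma prod_num_occurrences:
  "(\<Prod>j\<in>{1..d}. num_occurrences (k j) (\<sigma> j) n \<pi>) =
   card {x \<in> (SIGMA j:{1..d}. {1..k j}) \<rightarrow>\<^sub>E {1..n}. pattern_condition d k \<sigma> (term_val \<pi> x)}"
proof -
  let ?V = "SIGMA j:{1..d}. {1..k j}"
  let ?X = "{x \<in> ?V \<rightarrow>\<^sub>E {1..n}. pattern_condition d k \<sigma> (term_val \<pi> x)}"
  let ?O = "\<Pi>\<^sub>E j\<in>{1..d}. occurrences (k j) (\<sigma> j) n \<pi>"
  let ?c = "\<lambda>x. \<lambda>j\<in>{1..d}. \<lambda>a\<in>{1..k j}. x (j, a)"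
  let ?u = "\<lambda>f. \<lambda>(j, a)\<in>?V. f j a"
  have "(\<Prod>j\<in>{1..d}. num_occurrences (k j) (\<sigma> j) n \<pi>) = card ?O"
    by (simp add: card_PiE num_occurrences_def)
  also have "card ?O = card ?X"
  proof (rule bij_betw_same_card[of ?u], rule bij_betw_byWitness[where f' = ?c])
    show "\<forall>f\<in>?O. ?c (?u f) = f"
    proof
      fix f assume f: "f \<in> ?O"
      show "?c (?u f) = f"
      proof (intro ext)
        fix j a show "?c (?u f) j a = f j a"
        proof (cases "j \<in> {1..d}")
          case True
          then have "f j \<in> extensional {1..k j}"
            using f by (auto simp: occurrences_def PiE_def)
          then show ?thesis using True by (auto simp: extensional_def)
        qed (use f in \<open>auto simp: PiE_def extensional_def\<close>)
      qed
    qed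
    show "\<forall>x\<in>?X. ?u (?c x) = x"
      by (auto simp: fun_eq_iff PiE_def extensional_def)
    show "?u ` ?O \<subseteq> ?X"
    proof (rule image_subsetI)
      fix f assume "f \<in> ?O"
      then have f: "f j \<in> occurrences (k j) (\<sigma> j) n \<pi>" if "j \<in> {1..d}" for j
        using that by auto
      have "f j a \<in> {1..n}" if "j \<in> {1..d}" "a \<in> {1..k j}" for j a
        using f[OF that(1)] that(2) by (auto simp only: occurrences_def mem_Collect_eq PiE_iff)
      then have "?u f \<in> ?V \<rightarrow>\<^sub>E {1..n}"
        by (simp add: PiE_iff)
      moreover have "pattern_condition d k \<sigma> (term_val \<pi> (?u f))"
        using f by (auto simp: pattern_condition_def term_val_def occurrences_def strict_mono_on_def)
      ultimately show "?u f \<in> ?X" by blast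
    qed
    show "?c ` ?X \<subseteq> ?O"
    proof (rule image_subsetI)
      fix x assume x: "x \<in> ?X"
      have "(\<lambda>a\<in>{1..k j}. x (j, a)) \<in> occurrences (k j) (\<sigma> j) n \<pi>" if "j \<in> {1..d}" for j
        using x that
        by (auto simp: pattern_condition_def term_val_def occurrences_def strict_mono_on_def)
      then show "?c x \<in> ?O" by auto
    qed
  qed
  finally show ?thesis .
qed

lemma cycle_poly_pattern_moment:
  "cycle_poly (\<Sum>j\<in>{1..d}. k j) (\<lambda>n \<pi>. pattern_moment d k \<sigma> n \<pi>)"
proof -
  let ?V = "SIGMA j:{1..d}. {1..k j}"
  \<comment> \<open>The degree bound is the number of unknowns, one for each entry of each
    pattern.\<close>
  have "card ?V = (\<Sum>j\<in>{1..d}. k j)" "finite ?V" by simp_all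
  with cycle_poly_average[OF _ order_invariant_pattern_condition[of d k \<sigma>]]
  have "cycle_poly (\<Sum>j\<in>{1..d}. k j) (\<lambda>n \<pi>. (\<Sum>\<tau> | \<tau> permutes {1..n}. \<Sum>x\<in>?V \<rightarrow>\<^sub>E {1..n}.
      of_bool (pattern_condition d k \<sigma> (term_val (\<tau> \<circ> \<pi> \<circ> inv \<tau>) x))) / fact n)"
    by simp
  then show ?thesis
  proof (rule cycle_poly_cong)
    fix n :: nat and \<pi> :: "nat \<Rightarrow> nat"
    have fin: "finite (?V \<rightarrow>\<^sub>E {1..n})" by (simp add: finite_PiE)
    have "(\<Prod>j\<in>{1..d}. of_nat (num_occurrences (k j) (\<sigma> j) n \<pi>')) =
        (\<Sum>x\<in>?V \<rightarrow>\<^sub>E {1..n}. of_bool (pattern_condition d k \<sigma> (term_val \<pi>' x)) :: rat)" for \<pi>'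
    proof -
      have "(\<Prod>j\<in>{1..d}. of_nat (num_occurrences (k j) (\<sigma> j) n \<pi>') :: rat) =
          of_nat (\<Prod>j\<in>{1..d}. num_occurrences (k j) (\<sigma> j) n \<pi>')" by simp
      also have "\<dots> = (\<Sum>x\<in>?V \<rightarrow>\<^sub>E {1..n}. of_bool (pattern_condition d k \<sigma> (term_val \<pi>' x)))"
        unfolding prod_num_occurrences sum_of_bool_card[OF fin] ..
      finally show ?thesis .
    qed
    then show "pattern_moment d k \<sigma> n \<pi> = (\<Sum>\<tau> | \<tau> permutes {1..n}. \<Sum>x\<in>?V \<rightarrow>\<^sub>E {1..n}.
        of_bool (pattern_condition d k \<sigma> (term_val (\<tau> \<circ> \<pi> \<circ> inv \<tau>) x))) / fact n"
      unfolding pattern_moment_def by (simp only: conj_class_average)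
  qed
qed

text \<open>A variable \<open>VarM i\<close> that occurs has exponent at least 1 and so contributes
  at least \<open>i\<close> to the weighted degree of its monomial.\<close>

lemma mvpoly_vars_wdegree_bound:
  assumes "VarM 0 \<notin> mvpoly_vars Q" "mvpoly_wdegree var_weight Q \<le> D"
  shows "mvpoly_vars Q \<subseteq> insert VarN (VarM ` {1..D})"
proof
  fix v assume "v \<in> mvpoly_vars Q"
  then obtain m where m: "m \<in> Poly_Mapping.keys Q" "v \<in> Poly_Mapping.keys m"
    by (auto simp: mvpoly_vars_def)
  show "v \<in> insert VarN (VarM ` {1..D})"
  proof (cases v)
    case (VarM i)
    have "i \<le> Poly_Mapping.lookup m v * var_weight v"
      using m(2) VarM by (simp add: in_keys_iff)
    also have "\<dots> \<le> mono_wdegree var_weight m"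
      unfolding mono_wdegree_def by (rule member_le_sum) (use m(2) in auto)
    also have "\<dots> \<le> D"
      using assms(2) m(1) by (simp add: mvpoly_wdegree_le_iff)
    finally have "i \<le> D" .
    moreover have "i \<noteq> 0"
      using assms(1) \<open>v \<in> mvpoly_vars Q\<close> VarM by metis
    ultimately show ?thesis using VarM by simp
  qed simp
qed

theorem theorem1p2:
  fixes d K :: nat and k :: "nat \<Rightarrow> nat" and \<sigma> :: "nat \<Rightarrow> nat \<Rightarrow> nat"
  assumes "\<And>j. j \<in> {1..d} \<Longrightarrow> \<sigma> j permutes {1..k j}"
    and "K = (\<Sum>j\<in>{1..d}. k j)"
  shows "\<exists>Q :: (var, rat) mvpoly.
           mvpoly_vars Q \<subseteq> insert VarN (VarM ` {1..K}) \<and>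
           mvpoly_wdegree var_weight Q \<le> K \<and>
           (\<forall>n\<ge>1. \<forall>\<pi>. \<pi> permutes {1..n} \<longrightarrow>
              pattern_moment d k \<sigma> n \<pi> = mvpoly_eval (var_value n \<pi>) Q)"
proof -
  obtain Q :: "(var, rat) mvpoly" where
    Q: "VarM 0 \<notin> mvpoly_vars Q" "mvpoly_wdegree var_weight Q \<le> K"
       "\<forall>n \<pi>. \<pi> permutes {1..n} \<longrightarrow> pattern_moment d k \<sigma> n \<pi> = mvpoly_eval (var_value n \<pi>) Q"
    using cycle_poly_pattern_moment[of k d \<sigma>] assms(2) unfolding cycle_poly_def by blast
  then show ?thesis
    using mvpoly_vars_wdegree_bound[OF Q(1,2)] by blast
qed

end
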